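(* The $P_2$ set $\{7,41,82\}$ cannot be extended; that is, there is no positive integer $m\notin\{7,41,82\}$ such that $\{7,41,82,m\}$ is a $P_2$ set.
   Context: Let $n$ be an integer. A set $\{a_1,\dots,a_r\}$ of $r$ distinct positive integers has the property $D(n)$, and is called a $P_n$ set of size $r$ (or a Diophantine $r$-tuple with the property $D(n)$), if $a_ia_j+n$ is a perfect square (the square of an integer) for all $1\le i<j\le r$. A $P_n$ set of size 3 cannot be extended (is non-extendable) if it cannot be enlarged to a $P_n$ set of size 4 (a Diophantine quadruple with the property $D(n)$) by adjoining a further positive integer distinct from its elements. *)

theory Defs
  imports "HOL-Computational_Algebra.Nth_Powers"
begin

text \<open>
  The integer \<open>n\<close> may be negative, so everything lives in \<open>int\<close>. The finiteness
  conjunct excludes infinite sets, whose cardinality is \<open>0\<close> by convention.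
\<close>

definition P_set :: "int \<Rightarrow> nat \<Rightarrow> int set \<Rightarrow> bool" where
  "P_set n r A \<longleftrightarrow>
     finite A \<and> card A = r \<and> (\<forall>a\<in>A. 0 < a) \<and>
     (\<forall>a\<in>A. \<forall>b\<in>A. a \<noteq> b \<longrightarrow> is_square (a * b + n))"

definition non_extendable :: "int \<Rightarrow> int set \<Rightarrow> bool" where
  "non_extendable n A \<longleftrightarrow> \<not> (\<exists>m. 0 < m \<and> m \<notin> A \<and> P_set n (card A + 1) (insert m A))"

end

theory Submission
  imports Defs
begin

text \<open>
  The obstruction to extending the triple is purely a matter of residues modulo \<open>4\<close>. A square
  is \<open>0\<close> or \<open>1\<close> modulo \<open>4\<close>, so if \<open>n \<equiv> 2\<close> then a product \<open>a b\<close> with \<open>a b + n\<close> a square must be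
  \<open>2\<close> or \<open>3\<close> modulo \<open>4\<close>. Two even numbers have product \<open>0\<close>, and two odd numbers in the same
  class have product \<open>1\<close>; hence a set with the property \<open>D(n)\<close> contains at most one even
  number, at most one number \<open>\<equiv> 1\<close> and at most one number \<open>\<equiv> 3\<close>. So no such set has
  more than three elements (lemma \<open>P_set_card_le_3\<close>), whatever the triple one starts from.
  The triple itself is witnessed by \<open>7 \<cdot> 41 + 2 = 17\<^sup>2\<close>, \<open>7 \<cdot> 82 + 2 = 24\<^sup>2\<close> and
  \<open>41 \<cdot> 82 + 2 = 58\<^sup>2\<close>.
\<close>

lemma is_square_int_mod_4:
  fixes x :: int
  assumes "is_square x"
  shows "x mod 4 = 0 \<or> x mod 4 = 1"
proof -
  obtain y where x: "x = y ^ 2"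
    using assms by (auto elim: is_nth_powerE)
  have "y mod 4 = 0 \<or> y mod 4 = 1 \<or> y mod 4 = 2 \<or> y mod 4 = 3"
    by presburger
  then have "(y mod 4) ^ 2 mod 4 = 0 \<or> (y mod 4) ^ 2 mod 4 = 1"
    by auto
  then show ?thesis
    by (simp add: x power_mod)
qed

text \<open>
  The values \<open>0\<close>, \<open>1\<close>, \<open>3\<close> name the three kinds of number of which a \<open>P\<^sub>n\<close> set with
  \<open>n \<equiv> 2 (mod 4)\<close> holds at most one each. The residues \<open>0\<close> and \<open>2\<close> are merged because the
  product of any two even numbers is already divisible by \<open>4\<close>.
\<close>

definition merged_residue :: "int \<Rightarrow> int" where
  "merged_residue a = (if even a then 0 else a mod 4)"

lemma merged_residue_neq:
  fixes a b n :: int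
  assumes n: "n mod 4 = 2" and square: "is_square (a * b + n)"
  shows "merged_residue a \<noteq> merged_residue b"
proof
  assume eq: "merged_residue a = merged_residue b"
  have "a * b mod 4 = 0 \<or> a * b mod 4 = 1"
  proof (cases "even a")
    case True
    with eq have "even b"
      by (auto simp: merged_residue_def split: if_splits)
    with True have "2 * 2 dvd a * b"
      by (intro mult_dvd_mono)
    then show ?thesis
      by auto
  next
    case False
    with eq have "a mod 4 = b mod 4"
      by (auto simp: merged_residue_def split: if_splits)
    then have "a * b mod 4 = a ^ 2 mod 4"
      by (metis mod_mult_right_eq power2_eq_square)
    then show ?thesis
      using is_square_int_mod_4[of "a ^ 2"] by simp
  qed
  then have "(a * b + n) mod 4 = 2 \<or> (a * b + n) mod 4 = 3"
    using n by presburger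
  then show False
    using is_square_int_mod_4[OF square] by auto
qed

text \<open>
  Pigeonhole: \<open>merged_residue\<close> separates the elements of the set and takes only three values.
\<close>

lemma P_set_card_le_3:
  assumes n: "n mod 4 = 2" and A: "P_set n r A"
  shows "r \<le> 3"
proof -
  have "inj_on merged_residue A"
    using A merged_residue_neq[OF n] unfolding P_set_def inj_on_def by blast
  moreover have "merged_residue ` A \<subseteq> {0, 1, 3}"
    unfolding merged_residue_def by auto presburger
  ultimately have "card A \<le> card {0, 1, 3 :: int}"
    by (intro card_inj_on_le) auto
  then show ?thesis
    using A by (simp add: P_set_def)
qed

theorem theorem6:
  shows "P_set 2 3 {7, 41, 82} \<and> non_extendable 2 {7, 41, 82}"
proof
  have "is_square (17 ^ 2 :: int)" "is_square (24 ^ 2 :: int)" "is_square (58 ^ 2 :: int)"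
    by (rule is_nth_power_nth_power)+
  then show "P_set 2 3 {7, 41, 82}"
    by (simp add: P_set_def)
  show "non_extendable 2 {7, 41, 82}"
    using P_set_card_le_3[of 2 4] by (auto simp: non_extendable_def eval_nat_numeral)
qed

end
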